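(* Let $(A,\cdot)$ be an anti-Leibniz algebra, $r=\sum_i x_i\otimes y_i\in A\otimes A$, and let $\Delta_r:A\to A\otimes A$ be the linear map $\Delta_r(a)=T_a(r)$, where $T_a:=(\mathbf{r}_A-\mathbf{l}_A)(a)\otimes\mathrm{id}+\mathrm{id}\otimes\mathbf{r}_A(a)$. Then $(A,\cdot,\Delta_r)$ is an anti-Leibniz bialgebra if and only if the following three equations hold for all $a,a_1,a_2\in A$: $$\big((\mathbf{l}_A-\mathbf{r}_A)(a)\otimes\mathrm{id}\otimes\mathrm{id}\big)[\![r,r]\!]+\big(\mathrm{id}\otimes\mathrm{id}\otimes\mathbf{r}_A(a)+\mathrm{id}\otimes(\mathbf{l}_A-\mathbf{r}_A)(a)\otimes\mathrm{id}\big)\Big((\tau\otimes\mathrm{id})[\![r,r]\!]+\sum_i T_{x_i}(r-\tau(r))\otimes y_i\Big)+\sum_j\big((\mathbf{l}_A-\mathbf{r}_A)(x_j)\otimes\mathrm{id}\otimes\mathrm{id}\big)\big(\tau(T_a(r-\tau(r)))\otimes y_j\big)=0,$$ $$\Big(((\mathbf{r}_A-\mathbf{l}_A)(a_2)\otimes\mathrm{id})\tau+(\mathrm{id}\otimes\mathrm{id}-\tau)(\mathbf{r}_A(a_2)\otimes\mathrm{id})\Big)\big(T_{a_1}(r-\tau(r))\big)+\tau(\mathbf{r}_A(a_1)\otimes\mathrm{id})\big(T_{a_2}(r-\tau(r))\big)=0,$$ $$(\mathbf{r}_A(a_1)\otimes\mathrm{id})\big(T_{a_2}(r-\tau(r))\big)=0.$$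 In particular, if (i) $r-\tau(r)$ is invariant and $r$ is a solution of the anti-Leibniz Yang–Baxter equation in $(A,\cdot)$, or (ii) $r$ is a symmetric solution (i.e. $r=\tau(r)$) of the anti-Leibniz Yang–Baxter equation in $(A,\cdot)$, then $(A,\cdot,\Delta_r)$ is an anti-Leibniz bialgebra.
   Context: $\Bbbk$ is a field of characteristic zero; all vector spaces and algebras are finite-dimensional over $\Bbbk$. $\tau(a\otimes b)=b\otimes a$. An anti-Leibniz algebra $(A,\cdot)$ is a vector space with a bilinear product such that $a_1(a_2a_3)+(a_1a_2)a_3+a_2(a_1a_3)=0$. $\mathbf{l}_A(a)(b)=ab$, $\mathbf{r}_A(a)(b)=ba$. An anti-Leibniz coalgebra is $(A,\Delta)$ with $\Delta:A\to A\otimes A$ linear and $(\Delta\otimes\mathrm{id})\Delta+(\mathrm{id}\otimes\Delta)\Delta+(\tau\otimes\mathrm{id})(\mathrm{id}\otimes\Delta)\Delta=0$. An anti-Leibniz bialgebra is a triple $(A,\cdot,\Delta)$ with $(A,\cdot)$ an anti-Leibniz algebra, $(A,\Delta)$ an anti-Leibniz coalgebra and for all $a_1,a_2\in A$: $\Delta(a_1a_2)+\big((\mathrm{id}\otimes\mathbf{r}_A(a_2)-\mathbf{r}_A(a_2)\otimes\mathrm{id}+\mathbf{l}_A(a_2)\otimes\mathrm{id})(\mathrm{id}\otimes\mathrm{id}-\tau)\big)\Delta(a_1)+(\mathrm{id}\otimes\mathbf{l}_A(a_1)+\mathbf{l}_A(a_1)\otimes\mathrm{id})\Delta(a_2)=0$,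 $(\mathbf{r}_A(a_1)\otimes\mathrm{id})\Delta(a_2)-\tau\big((\mathbf{r}_A(a_2)\otimes\mathrm{id})\Delta(a_1)\big)=0$. For $r=\sum_i x_i\otimes y_i$, $[\![r,r]\!]:=\sum_{i,j}\big(x_ix_j\otimes y_i\otimes y_j+x_i\otimes y_ix_j\otimes y_j-x_j\otimes x_iy_j\otimes y_i-x_j\otimes x_i\otimes y_iy_j\big)$ $(=r_{12}r_{13}+r_{12}r_{23}-r_{23}r_{12}-r_{23}r_{13})$. The equation $[\![r,r]\!]=0$ is the anti-Leibniz Yang–Baxter equation in $(A,\cdot)$. An element $s\in A\otimes A$ is invariant if $T_a(s)=0$ for all $a\in A$. *)

theory Defs
  imports Complex_Main "HOL-Library.Function_Algebras"
begin

text \<open>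
  Let \<open>s\<close> be the scalar multiplication of a vector space \<open>A\<close> whose carrier is a whole type.
  The tensor \<open>x \<otimes> y\<close> is represented by the form \<open>(f, g) \<mapsto> f x * g y\<close> on pairs of linear
  forms, and \<open>A \<otimes> A\<close> by the span of these pure tensors; similarly for three factors.  As linear
  forms separate points, this is a model of the algebraic tensor product: see the universal
  properties \<open>tensor2_universal\<close> and \<open>tensor3_universal\<close> below.  Arguments that are not
  linear forms are sent to 0, so that equality of tensors is equality of functions; sums,
  differences and 0 are the pointwise ones.
\<close>

type_synonym ('k, 'a) tensor2 = "('a \<Rightarrow> 'k) \<Rightarrow> ('a \<Rightarrow> 'k) \<Rightarrow> 'k"
type_synonym ('k, 'a) tensor3 = "('a \<Rightarrow> 'k) \<Rightarrow> ('a \<Rightarrow> 'k) \<Rightarrow> ('a \<Rightarrow> 'k) \<Rightarrow> 'k"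

definition linear_form :: "('k::field \<Rightarrow> 'a::ab_group_add \<Rightarrow> 'a) \<Rightarrow> ('a \<Rightarrow> 'k) \<Rightarrow> bool" where
  "linear_form s f \<longleftrightarrow> Vector_Spaces.linear s (*) f"

definition on_forms2 ::
    "('k::field \<Rightarrow> 'a::ab_group_add \<Rightarrow> 'a) \<Rightarrow> ('k, 'a) tensor2 \<Rightarrow> ('k, 'a) tensor2" where
  "on_forms2 s F = (\<lambda>f g. if linear_form s f \<and> linear_form s g then F f g else 0)"

definition on_forms3 ::
    "('k::field \<Rightarrow> 'a::ab_group_add \<Rightarrow> 'a) \<Rightarrow> ('k, 'a) tensor3 \<Rightarrow> ('k, 'a) tensor3" where
  "on_forms3 s F =
    (\<lambda>f g h. if linear_form s f \<and> linear_form s g \<and> linear_form s h then F f g h else 0)"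

definition pure2 :: "('k::field \<Rightarrow> 'a::ab_group_add \<Rightarrow> 'a) \<Rightarrow> 'a \<Rightarrow> 'a \<Rightarrow> ('k, 'a) tensor2" where
  "pure2 s x y = on_forms2 s (\<lambda>f g. f x * g y)"

definition pure3 ::
    "('k::field \<Rightarrow> 'a::ab_group_add \<Rightarrow> 'a) \<Rightarrow> 'a \<Rightarrow> 'a \<Rightarrow> 'a \<Rightarrow> ('k, 'a) tensor3" where
  "pure3 s x y z = on_forms3 s (\<lambda>f g h. f x * g y * h z)"

definition scale2 :: "'k::field \<Rightarrow> ('k, 'a) tensor2 \<Rightarrow> ('k, 'a) tensor2" where
  "scale2 c t = (\<lambda>f g. c * t f g)"

definition tensors2 :: "('k::field \<Rightarrow> 'a::ab_group_add \<Rightarrow> 'a) \<Rightarrow> ('k, 'a) tensor2 set" where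
  "tensors2 s = module.span scale2 {pure2 s x y | x y. True}"

text \<open>
  The operators below are given by formulas on forms.  On pure tensors they are the expected ones:
  \<open>\<tau>(x \<otimes> y) = y \<otimes> x\<close>, \<open>(\<phi> \<otimes> \<psi>)(x \<otimes> y) = \<phi> x \<otimes> \<psi> y\<close>, \<open>(D \<otimes> id)(x \<otimes> y) = D x \<otimes> y\<close>, etc.;
  these equations and additivity are proved below.
\<close>

text \<open>\<open>\<tau>\<close> and \<open>\<tau> \<otimes> id\<close>.\<close>

definition flip2 :: "('k, 'a) tensor2 \<Rightarrow> ('k, 'a) tensor2" where
  "flip2 t = (\<lambda>f g. t g f)"

definition flip12 :: "('k, 'a) tensor3 \<Rightarrow> ('k, 'a) tensor3" where
  "flip12 t = (\<lambda>f g h. t g f h)"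

text \<open>\<open>\<phi> \<otimes> \<psi>\<close> and \<open>\<phi> \<otimes> \<psi> \<otimes> \<chi>\<close>, for linear maps \<open>A \<rightarrow> A\<close>.\<close>

definition tmap2 :: "('k::field \<Rightarrow> 'a::ab_group_add \<Rightarrow> 'a) \<Rightarrow> ('a \<Rightarrow> 'a) \<Rightarrow> ('a \<Rightarrow> 'a) \<Rightarrow>
    ('k, 'a) tensor2 \<Rightarrow> ('k, 'a) tensor2" where
  "tmap2 s \<phi> \<psi> t = on_forms2 s (\<lambda>f g. t (f \<circ> \<phi>) (g \<circ> \<psi>))"

definition tmap3 :: "('k::field \<Rightarrow> 'a::ab_group_add \<Rightarrow> 'a) \<Rightarrow> ('a \<Rightarrow> 'a) \<Rightarrow> ('a \<Rightarrow> 'a) \<Rightarrow> ('a \<Rightarrow> 'a) \<Rightarrow>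
    ('k, 'a) tensor3 \<Rightarrow> ('k, 'a) tensor3" where
  "tmap3 s \<phi> \<psi> \<chi> t = on_forms3 s (\<lambda>f g h. t (f \<circ> \<phi>) (g \<circ> \<psi>) (h \<circ> \<chi>))"

text \<open>\<open>u \<otimes> y\<close> for \<open>u \<in> A \<otimes> A\<close> and \<open>y \<in> A\<close>, and \<open>x \<otimes> u\<close> likewise.\<close>

definition append_right ::
    "('k::field \<Rightarrow> 'a::ab_group_add \<Rightarrow> 'a) \<Rightarrow> ('k, 'a) tensor2 \<Rightarrow> 'a \<Rightarrow> ('k, 'a) tensor3" where
  "append_right s u y = on_forms3 s (\<lambda>f g h. u f g * h y)"

definition append_left ::
    "('k::field \<Rightarrow> 'a::ab_group_add \<Rightarrow> 'a) \<Rightarrow> 'a \<Rightarrow> ('k, 'a) tensor2 \<Rightarrow> ('k, 'a) tensor3" where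
  "append_left s x u = on_forms3 s (\<lambda>f g h. f x * u g h)"

text \<open>\<open>D \<otimes> id\<close> and \<open>id \<otimes> D\<close>, for a linear map \<open>D : A \<rightarrow> A \<otimes> A\<close>.\<close>

definition comap_left :: "('k::field \<Rightarrow> 'a::ab_group_add \<Rightarrow> 'a) \<Rightarrow> ('a \<Rightarrow> ('k, 'a) tensor2) \<Rightarrow>
    ('k, 'a) tensor2 \<Rightarrow> ('k, 'a) tensor3" where
  "comap_left s D t = on_forms3 s (\<lambda>f g h. t (\<lambda>a. D a f g) h)"

definition comap_right :: "('k::field \<Rightarrow> 'a::ab_group_add \<Rightarrow> 'a) \<Rightarrow> ('a \<Rightarrow> ('k, 'a) tensor2) \<Rightarrow>
    ('k, 'a) tensor2 \<Rightarrow> ('k, 'a) tensor3" where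
  "comap_right s D t = on_forms3 s (\<lambda>f g h. t f (\<lambda>a. D a g h))"

definition anti_leibniz_algebra ::
    "('k::field \<Rightarrow> 'a::ab_group_add \<Rightarrow> 'a) \<Rightarrow> ('a \<Rightarrow> 'a \<Rightarrow> 'a) \<Rightarrow> bool" where
  "anti_leibniz_algebra s m \<longleftrightarrow>
    (\<forall>a. Vector_Spaces.linear s s (\<lambda>b. m a b)) \<and>
    (\<forall>b. Vector_Spaces.linear s s (\<lambda>a. m a b)) \<and>
    (\<forall>a1 a2 a3. m a1 (m a2 a3) + m (m a1 a2) a3 + m a2 (m a1 a3) = 0)"

definition lmul :: "('a \<Rightarrow> 'a \<Rightarrow> 'a) \<Rightarrow> 'a \<Rightarrow> 'a \<Rightarrow> 'a" where
  "lmul m a = (\<lambda>b. m a b)"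

definition rmul :: "('a \<Rightarrow> 'a \<Rightarrow> 'a) \<Rightarrow> 'a \<Rightarrow> 'a \<Rightarrow> 'a" where
  "rmul m a = (\<lambda>b. m b a)"

definition anti_leibniz_coalgebra ::
    "('k::field \<Rightarrow> 'a::ab_group_add \<Rightarrow> 'a) \<Rightarrow> ('a \<Rightarrow> ('k, 'a) tensor2) \<Rightarrow> bool" where
  "anti_leibniz_coalgebra s D \<longleftrightarrow>
    Vector_Spaces.linear s scale2 D \<and> range D \<subseteq> tensors2 s \<and>
    (\<forall>a. comap_left s D (D a) + comap_right s D (D a) + flip12 (comap_right s D (D a)) = 0)"

definition anti_leibniz_bialgebra ::
    "('k::field \<Rightarrow> 'a::ab_group_add \<Rightarrow> 'a) \<Rightarrow> ('a \<Rightarrow> 'a \<Rightarrow> 'a) \<Rightarrow>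
      ('a \<Rightarrow> ('k, 'a) tensor2) \<Rightarrow> bool" where
  "anti_leibniz_bialgebra s m D \<longleftrightarrow>
    anti_leibniz_algebra s m \<and> anti_leibniz_coalgebra s D \<and>
    (\<forall>a1 a2.
      D (m a1 a2)
      + (tmap2 s id (rmul m a2) (D a1 - flip2 (D a1))
         - tmap2 s (rmul m a2) id (D a1 - flip2 (D a1))
         + tmap2 s (lmul m a2) id (D a1 - flip2 (D a1)))
      + (tmap2 s id (lmul m a1) (D a2) + tmap2 s (lmul m a1) id (D a2)) = 0) \<and>
    (\<forall>a1 a2. tmap2 s (rmul m a1) id (D a2) - flip2 (tmap2 s (rmul m a2) id (D a1)) = 0)"

text \<open>\<open>T\<^sub>a = (r\<^sub>A - l\<^sub>A)(a) \<otimes> id + id \<otimes> r\<^sub>A(a)\<close>.\<close>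

definition T_op :: "('k::field \<Rightarrow> 'a::ab_group_add \<Rightarrow> 'a) \<Rightarrow> ('a \<Rightarrow> 'a \<Rightarrow> 'a) \<Rightarrow> 'a \<Rightarrow>
    ('k, 'a) tensor2 \<Rightarrow> ('k, 'a) tensor2" where
  "T_op s m a u = tmap2 s (rmul m a - lmul m a) id u + tmap2 s id (rmul m a) u"

definition Delta_r :: "('k::field \<Rightarrow> 'a::ab_group_add \<Rightarrow> 'a) \<Rightarrow> ('a \<Rightarrow> 'a \<Rightarrow> 'a) \<Rightarrow>
    ('k, 'a) tensor2 \<Rightarrow> 'a \<Rightarrow> ('k, 'a) tensor2" where
  "Delta_r s m r = (\<lambda>a. T_op s m a r)"

definition invariant2 :: "('k::field \<Rightarrow> 'a::ab_group_add \<Rightarrow> 'a) \<Rightarrow> ('a \<Rightarrow> 'a \<Rightarrow> 'a) \<Rightarrow>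
    ('k, 'a) tensor2 \<Rightarrow> bool" where
  "invariant2 s m u \<longleftrightarrow> (\<forall>a. T_op s m a u = 0)"

text \<open>
  \<open>[[r, r]]\<close> for \<open>r = \<Sum>i\<in>I. x i \<otimes> y i\<close>; it depends on \<open>r\<close> only, see
  \<open>yb_bracket_well_defined\<close>.
\<close>

definition yb_bracket :: "('k::field \<Rightarrow> 'a::ab_group_add \<Rightarrow> 'a) \<Rightarrow> ('a \<Rightarrow> 'a \<Rightarrow> 'a) \<Rightarrow>
    'i set \<Rightarrow> ('i \<Rightarrow> 'a) \<Rightarrow> ('i \<Rightarrow> 'a) \<Rightarrow> ('k, 'a) tensor3" where
  "yb_bracket s m I x y = (\<Sum>i\<in>I. \<Sum>j\<in>I.
      pure3 s (m (x i) (x j)) (y i) (y j)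
    + pure3 s (x i) (m (y i) (x j)) (y j)
    - pure3 s (x j) (m (x i) (y j)) (y i)
    - pure3 s (x j) (x i) (m (y i) (y j)))"


subsection \<open>The tensor model\<close>

lemma sum_fun_apply: "(\<Sum>i\<in>I. F i) z = (\<Sum>i\<in>I. F i z)"
  for F :: "'i \<Rightarrow> 'b \<Rightarrow> 'c::comm_monoid_add"
  by (induction I rule: infinite_finite_induct) auto

lemma linear_formD:
  assumes "linear_form s f"
  shows "f (x + y) = f x + f y" "f (x - y) = f x - f y" "f 0 = 0" "f (s c x) = c * f x"
    "f (\<Sum>i\<in>I. z i) = (\<Sum>i\<in>I. f (z i))"
proof -
  interpret Vector_Spaces.linear s "(*)" f using assms by (simp add: linear_form_def)
  show "f (x + y) = f x + f y" "f (x - y) = f x - f y" "f 0 = 0" "f (s c x) = c * f x"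
    "f (\<Sum>i\<in>I. z i) = (\<Sum>i\<in>I. f (z i))"
    by (simp_all add: add diff zero scale sum)
qed

lemma linear_form_comp:
  assumes "linear_form s f" "Vector_Spaces.linear s s \<phi>"
  shows "linear_form s (f \<circ> \<phi>)"
  using assms Vector_Spaces.linear_compose unfolding linear_form_def by blast

lemma vector_space_scale2: "vector_space (scale2 :: 'k::field \<Rightarrow> ('k, 'a) tensor2 \<Rightarrow> _)"
  by standard (auto simp: scale2_def fun_eq_iff algebra_simps)

lemma on_forms_eqI:
  "(\<And>f g. linear_form s f \<Longrightarrow> linear_form s g \<Longrightarrow> F f g = G f g) \<Longrightarrow>
    on_forms2 s F = on_forms2 s G"
  "(\<And>f g h. linear_form s f \<Longrightarrow> linear_form s g \<Longrightarrow> linear_form s h \<Longrightarrow> F' f g h = G' f g h) \<Longrightarrow>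
    on_forms3 s F' = on_forms3 s G'"
  by (simp_all add: on_forms2_def on_forms3_def fun_eq_iff)

lemma on_forms_add:
  "on_forms2 s F + on_forms2 s G = on_forms2 s (\<lambda>f g. F f g + G f g)"
  "on_forms3 s F' + on_forms3 s G' = on_forms3 s (\<lambda>f g h. F' f g h + G' f g h)"
  by (simp_all add: on_forms2_def on_forms3_def fun_eq_iff)

lemma on_forms_scale:
  "scale2 c (on_forms2 s F) = on_forms2 s (\<lambda>f g. c * F f g)"
  "(\<lambda>f g h. c * on_forms3 s F' f g h) = on_forms3 s (\<lambda>f g h. c * F' f g h)"
  by (simp_all add: scale2_def on_forms2_def on_forms3_def fun_eq_iff)

lemma pure2_bilinear:
  "pure2 s (x + x') y = pure2 s x y + pure2 s x' y"
  "pure2 s x (y + y') = pure2 s x y + pure2 s x y'"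
  "pure2 s (s c x) y = scale2 c (pure2 s x y)"
  "pure2 s x (s c y) = scale2 c (pure2 s x y)"
  unfolding pure2_def on_forms_add on_forms_scale
  by (rule on_forms_eqI; simp only: linear_formD(1,4); simp add: algebra_simps)+

lemma pure2_in_tensors2: "pure2 s x y \<in> tensors2 s"
  for s :: "'k::field \<Rightarrow> 'a::ab_group_add \<Rightarrow> 'a"
proof -
  interpret vector_space "scale2 :: 'k \<Rightarrow> ('k, 'a) tensor2 \<Rightarrow> _" by (rule vector_space_scale2)
  show ?thesis unfolding tensors2_def by (rule span_base) blast
qed

lemma tensors2_iff_sum:
  "t \<in> tensors2 s \<longleftrightarrow> (\<exists>n x y. t = (\<Sum>i<n::nat. pure2 s (x i) (y i)))"
  for s :: "'k::field \<Rightarrow> 'a::ab_group_add \<Rightarrow> 'a"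
proof
  interpret V: vector_space "scale2 :: 'k \<Rightarrow> ('k, 'a) tensor2 \<Rightarrow> _" by (rule vector_space_scale2)
  show "\<exists>n x y. t = (\<Sum>i<n::nat. pure2 s (x i) (y i))" if "t \<in> tensors2 s"
    using that unfolding tensors2_def
  proof (induction rule: V.span_induct_alt)
    case base
    have "0 = (\<Sum>i<0::nat. pure2 s (x i) (y i))" for x y by simp
    then show ?case by blast
  next
    case (step c u t)
    obtain a b where u: "u = pure2 s a b" using step by blast
    obtain n x y where t: "t = (\<Sum>i<n::nat. pure2 s (x i) (y i))" using step by blast
    have "scale2 c u + t =
        (\<Sum>i<Suc n. pure2 s ((x(n := s c a)) i) ((y(n := b)) i))"
      unfolding sum.lessThan_Suc u t
      by (auto simp: pure2_bilinear add.commute intro!: sum.cong arg_cong2[where f = "(+)"])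
    then show ?case by blast
  qed
next
  interpret V: vector_space "scale2 :: 'k \<Rightarrow> ('k, 'a) tensor2 \<Rightarrow> _" by (rule vector_space_scale2)
  show "t \<in> tensors2 s" if "\<exists>n x y. t = (\<Sum>i<n::nat. pure2 s (x i) (y i))"
    using that pure2_in_tensors2[of s] unfolding tensors2_def by (auto intro!: V.span_sum)
qed

text \<open>
  A bilinear (trilinear) map respects every relation between pure tensors, i.e. it factors,
  necessarily uniquely, through the span of the pure tensors.
\<close>

lemma (in finite_dimensional_vector_space) tensor2_universal:
  assumes \<beta>: "\<And>a. Vector_Spaces.linear scale w (\<beta> a)" "\<And>b. Vector_Spaces.linear scale w (\<lambda>a. \<beta> a b)"
    and rel: "(\<Sum>i\<in>I. pure2 scale (x i) (y i)) = 0"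
  shows "(\<Sum>i\<in>I. \<beta> (x i) (y i)) = 0"
proof -
  interpret W: vector_space w using \<beta>(1)[of 0] unfolding Vector_Spaces.linear_def by blast
  define R where "R = (\<lambda>b v. representation Basis v b)"
  have R: "linear_form scale (R b)" for b
    unfolding linear_form_def R_def
    by (unfold_locales)
       (auto simp: algebra_simps representation_add representation_scale independent_Basis span_Basis)
  have eq: "v = (\<Sum>b\<in>Basis. scale (R b v) b)" for v
    using sum_representation_eq[OF independent_Basis _ finite_Basis, of v] span_Basis
    unfolding R_def by auto
  have exp: "\<beta> u v = (\<Sum>b\<in>Basis. \<Sum>c\<in>Basis. w (R b u * R c v) (\<beta> b c))" for u v
  proof -
    interpret L: Vector_Spaces.linear scale w "\<lambda>a. \<beta> a v" by (rule \<beta>)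
    have "\<beta> u v = (\<Sum>b\<in>Basis. w (R b u) (\<beta> b v))"
      by (subst eq[of u]) (simp add: L.sum L.scale)
    also have "\<dots> = (\<Sum>b\<in>Basis. w (R b u) (\<Sum>c\<in>Basis. w (R c v) (\<beta> b c)))"
    proof (intro sum.cong refl arg_cong[where f = "w _"])
      fix b
      interpret M: Vector_Spaces.linear scale w "\<beta> b" by (rule \<beta>)
      show "\<beta> b v = (\<Sum>c\<in>Basis. w (R c v) (\<beta> b c))"
        by (subst eq[of v]) (simp add: M.sum M.scale)
    qed
    finally show ?thesis by (simp add: W.scale_sum_right)
  qed
  have z: "(\<Sum>i\<in>I. R b (x i) * R c (y i)) = 0" for b c
    using fun_cong[OF fun_cong[OF rel, of "R b"], of "R c"]
    by (simp add: sum_fun_apply pure2_def on_forms2_def R)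
  have "(\<Sum>i\<in>I. \<beta> (x i) (y i)) =
      (\<Sum>b\<in>Basis. \<Sum>c\<in>Basis. w (\<Sum>i\<in>I. R b (x i) * R c (y i)) (\<beta> b c))"
    by (subst sum.cong[OF refl exp])
       (simp only: W.scale_sum_left sum.swap[of _ _ I])
  then show ?thesis by (simp add: z)
qed

lemma (in finite_dimensional_vector_space) tensor3_universal:
  assumes \<beta>: "\<And>a b. Vector_Spaces.linear scale w (\<lambda>c. \<beta> a b c)"
      "\<And>a c. Vector_Spaces.linear scale w (\<lambda>b. \<beta> a b c)"
      "\<And>b c. Vector_Spaces.linear scale w (\<lambda>a. \<beta> a b c)"
    and rel: "(\<Sum>i\<in>I. pure3 scale (x i) (y i) (z i)) = 0"
  shows "(\<Sum>i\<in>I. \<beta> (x i) (y i) (z i)) = 0"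
proof -
  interpret W: vector_space w using \<beta>(1)[of 0 0] unfolding Vector_Spaces.linear_def by blast
  define R where "R = (\<lambda>b v. representation Basis v b)"
  have R: "linear_form scale (R b)" for b
    unfolding linear_form_def R_def
    by (unfold_locales)
       (auto simp: algebra_simps representation_add representation_scale independent_Basis span_Basis)
  have eq: "v = (\<Sum>b\<in>Basis. scale (R b v) b)" for v
    using sum_representation_eq[OF independent_Basis _ finite_Basis, of v] span_Basis
    unfolding R_def by auto
  have exp1: "\<gamma> v = (\<Sum>b\<in>Basis. w (R b v) (\<gamma> b))" if "Vector_Spaces.linear scale w \<gamma>" for \<gamma> v
  proof -
    interpret L: Vector_Spaces.linear scale w \<gamma> by (rule that)
    show ?thesis by (subst eq[of v]) (simp add: L.sum L.scale)
  qed
  have exp: "\<beta> u v t =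
      (\<Sum>b\<in>Basis. \<Sum>c\<in>Basis. \<Sum>d\<in>Basis. w (R b u * R c v * R d t) (\<beta> b c d))" for u v t
  proof -
    have "\<beta> u v t = (\<Sum>b\<in>Basis. w (R b u) (\<beta> b v t))" by (rule exp1[OF \<beta>(3)])
    also have "\<dots> = (\<Sum>b\<in>Basis. w (R b u) (\<Sum>c\<in>Basis. w (R c v) (\<beta> b c t)))"
      by (intro sum.cong refl arg_cong[where f = "w _"] exp1[OF \<beta>(2)])
    also have "\<dots> = (\<Sum>b\<in>Basis. w (R b u) (\<Sum>c\<in>Basis. w (R c v)
        (\<Sum>d\<in>Basis. w (R d t) (\<beta> b c d))))"
      by (intro sum.cong refl arg_cong[where f = "w _"] exp1[OF \<beta>(1)])
    finally show ?thesis by (simp add: W.scale_sum_right mult.assoc)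
  qed
  have z: "(\<Sum>i\<in>I. R b (x i) * R c (y i) * R d (z i)) = 0" for b c d
    using fun_cong[OF fun_cong[OF fun_cong[OF rel, of "R b"], of "R c"], of "R d"]
    by (simp add: sum_fun_apply pure3_def on_forms3_def R)
  have "(\<Sum>i\<in>I. \<beta> (x i) (y i) (z i)) =
      (\<Sum>b\<in>Basis. \<Sum>c\<in>Basis. \<Sum>d\<in>Basis. w (\<Sum>i\<in>I. R b (x i) * R c (y i) * R d (z i)) (\<beta> b c d))"
    by (subst sum.cong[OF refl exp])
       (simp only: W.scale_sum_left sum.swap[of _ _ I])
  then show ?thesis by (simp add: z)
qed

lemma pure3_trilinear:
  "pure3 s (x + x') y z = pure3 s x y z + pure3 s x' y z"
  "pure3 s x (y + y') z = pure3 s x y z + pure3 s x y' z"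
  "pure3 s x y (z + z') = pure3 s x y z + pure3 s x y z'"
  "pure3 s (s c x) y z = (\<lambda>f g h. c * pure3 s x y z f g h)"
  "pure3 s x (s c y) z = (\<lambda>f g h. c * pure3 s x y z f g h)"
  "pure3 s x y (s c z) = (\<lambda>f g h. c * pure3 s x y z f g h)"
  unfolding pure3_def on_forms_add on_forms_scale
  by (rule on_forms_eqI; simp only: linear_formD(1,4); simp add: algebra_simps)+

lemma operators_additive:
  "flip2 (t + u) = flip2 t + flip2 u"
  "flip12 (v + w) = flip12 v + flip12 w"
  "tmap2 s \<phi> \<psi> (t + u) = tmap2 s \<phi> \<psi> t + tmap2 s \<phi> \<psi> u"
  "tmap3 s \<phi> \<psi> \<chi> (v + w) = tmap3 s \<phi> \<psi> \<chi> v + tmap3 s \<phi> \<psi> \<chi> w"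
  "append_right s (t + u) z = append_right s t z + append_right s u z"
  "append_left s z (t + u) = append_left s z t + append_left s z u"
  "comap_left s D (t + u) = comap_left s D t + comap_left s D u"
  "comap_right s D (t + u) = comap_right s D t + comap_right s D u"
  by (auto simp: flip2_def flip12_def tmap2_def tmap3_def append_right_def append_left_def
      comap_left_def comap_right_def on_forms2_def on_forms3_def fun_eq_iff algebra_simps)

lemma flip_pure:
  "flip2 (pure2 s x y) = pure2 s y x"
  "flip12 (pure3 s x y z) = pure3 s y x z"
  by (auto simp: flip2_def flip12_def pure2_def pure3_def on_forms2_def on_forms3_def fun_eq_iff
      mult.commute)

lemma tmap2_pure:
  assumes "Vector_Spaces.linear s s \<phi>" "Vector_Spaces.linear s s \<psi>"
  shows "tmap2 s \<phi> \<psi> (pure2 s x y) = pure2 s (\<phi> x) (\<psi> y)"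
  using assms by (auto simp: tmap2_def pure2_def on_forms2_def fun_eq_iff linear_form_comp)

lemma tmap3_pure:
  assumes "Vector_Spaces.linear s s \<phi>" "Vector_Spaces.linear s s \<psi>" "Vector_Spaces.linear s s \<chi>"
  shows "tmap3 s \<phi> \<psi> \<chi> (pure3 s x y z) = pure3 s (\<phi> x) (\<psi> y) (\<chi> z)"
  using assms by (auto simp: tmap3_def pure3_def on_forms3_def fun_eq_iff linear_form_comp)

lemma append_pure:
  "append_right s (pure2 s x y) z = pure3 s x y z"
  "append_left s x (pure2 s y z) = pure3 s x y z"
  by (auto simp: append_right_def append_left_def pure2_def pure3_def on_forms2_def on_forms3_def
      fun_eq_iff)

lemma comap_pure:
  assumes "Vector_Spaces.linear s scale2 D"
  shows "comap_left s D (pure2 s x y) = append_right s (D x) y"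
    "comap_right s D (pure2 s x y) = append_left s x (D y)"
proof -
  interpret D: Vector_Spaces.linear s scale2 D by (rule assms)
  have "linear_form s (\<lambda>a. D a f g)" for f g
    unfolding linear_form_def
    by unfold_locales (auto simp: D.add D.scale scale2_def algebra_simps)
  then show "comap_left s D (pure2 s x y) = append_right s (D x) y"
    "comap_right s D (pure2 s x y) = append_left s x (D y)"
    by (auto simp: comap_left_def comap_right_def append_right_def append_left_def pure2_def
        on_forms2_def on_forms3_def fun_eq_iff)
qed

lemma yb_bracket_well_defined:
  assumes alg: "anti_leibniz_algebra s m"
    and r: "(\<Sum>i\<in>I. pure2 s (x i) (y i)) = (\<Sum>i\<in>I'. pure2 s (x' i) (y' i))"
  shows "yb_bracket s m I x y = yb_bracket s m I' x' y'"
proof -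
  have lin: "linear_form s (\<lambda>b. f (m a b))" "linear_form s (\<lambda>b. f (m b a))"
    if "linear_form s f" for f a
    using alg that linear_form_comp[of s f] unfolding anti_leibniz_algebra_def comp_def by blast+
  have key: "yb_bracket s m J u v f g h =
      (let R = (\<Sum>i\<in>J. pure2 s (u i) (v i)) in
         R (\<lambda>a. R (\<lambda>b. f (m a b)) h) g + R f (\<lambda>a. R (\<lambda>b. g (m a b)) h)
         - R (\<lambda>a. R f (\<lambda>b. g (m a b))) h - R g (\<lambda>a. R f (\<lambda>b. h (m a b))))"
    if fgh: "linear_form s f" "linear_form s g" "linear_form s h" for J :: "'j set" and u v f g h
  proof -
    have R: "(\<Sum>i\<in>J. pure2 s (u i) (v i)) f' g' = (\<Sum>i\<in>J. f' (u i) * g' (v i))"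
      if "linear_form s f'" "linear_form s g'" for f' g'
      using that by (simp add: sum_fun_apply pure2_def on_forms2_def)
    have vs: "vector_space s" using alg unfolding anti_leibniz_algebra_def Vector_Spaces.linear_def
      by blast
    have add: "m (a + a') b = m a b + m a' b" and scale: "m (s c a) b = s c (m a b)" for a a' b c
    proof -
      interpret Vector_Spaces.linear s s "\<lambda>a. m a b"
        using alg unfolding anti_leibniz_algebra_def by blast
      show "m (a + a') b = m a b + m a' b" "m (s c a) b = s c (m a b)" by (simp_all add: add scale)
    qed
    have lf: "linear_form s F"
      if "\<And>a b. F (a + b) = F a + F b" "\<And>c a. F (s c a) = c * F a" for F
    proof -
      interpret vector_space s by (rule vs)
      show ?thesis unfolding linear_form_def
        by unfold_locales (use that in \<open>auto simp: algebra_simps\<close>)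
    qed
    have lf1: "linear_form s (\<lambda>a. \<Sum>i\<in>J. F (m a (u i)) * G i)"
      and lf2: "linear_form s (\<lambda>a. \<Sum>i\<in>J. G i * F (m a (v i)))" if "linear_form s F" for F G
      by (rule lf; simp add: add scale linear_formD(1,4)[OF that] algebra_simps sum.distrib
          sum_distrib_left)+
    define Q where "Q = (\<Sum>i\<in>J. pure2 s (u i) (v i))"
    have Q: "Q f' g' = (\<Sum>i\<in>J. f' (u i) * g' (v i))"
      if "linear_form s f'" "linear_form s g'" for f' g'
      unfolding Q_def using that by (rule R)
    have "Q (\<lambda>a. Q (\<lambda>b. f (m a b)) h) g = (\<Sum>i\<in>J. \<Sum>j\<in>J. f (m (u i) (u j)) * g (v i) * h (v j))"
      by (simp add: Q lin lf1[of f "\<lambda>i. h (v i)"] fgh) (simp add: sum_distrib_left sum_distrib_right mult_ac)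
    moreover have "Q f (\<lambda>a. Q (\<lambda>b. g (m a b)) h) =
        (\<Sum>i\<in>J. \<Sum>j\<in>J. f (u i) * g (m (v i) (u j)) * h (v j))"
      by (simp add: Q lin lf1[of g "\<lambda>i. h (v i)"] fgh) (simp add: sum_distrib_left sum_distrib_right mult_ac)
    moreover have "Q (\<lambda>a. Q f (\<lambda>b. g (m a b))) h =
        (\<Sum>i\<in>J. \<Sum>j\<in>J. f (u j) * g (m (u i) (v j)) * h (v i))"
      by (simp add: Q lin lf2[of g "\<lambda>i. f (u i)"] fgh) (simp add: sum_distrib_left sum_distrib_right mult_ac)
    moreover have "Q g (\<lambda>a. Q f (\<lambda>b. h (m a b))) =
        (\<Sum>i\<in>J. \<Sum>j\<in>J. f (u j) * g (u i) * h (m (v i) (v j)))"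
      by (simp add: Q lin lf2[of h "\<lambda>i. f (u i)"] fgh) (simp add: sum_distrib_left sum_distrib_right mult_ac)
    ultimately show ?thesis
      unfolding Q_def[symmetric] Let_def
      by (simp add: yb_bracket_def sum_fun_apply pure3_def on_forms3_def fgh sum.distrib sum_subtractf)
  qed
  show ?thesis
  proof (intro ext)
    fix f g h
    show "yb_bracket s m I x y f g h = yb_bracket s m I' x' y' f g h"
    proof (cases "linear_form s f \<and> linear_form s g \<and> linear_form s h")
      case True
      then show ?thesis by (simp add: key r Let_def)
    next
      case False
      then show ?thesis
        by (auto simp: yb_bracket_def sum_fun_apply pure3_def on_forms3_def)
    qed
  qed
qed

end

theory Submission
  imports Defs
begin

text \<open>
  Expanding \<open>\<Delta>\<^sub>r = T(r)\<close> into pure tensors and rewriting with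
  \<open>(ab)c = - a(bc) - b(ac)\<close>, the two compatibility conditions become literally the second and the
  third equation.  The coalgebra identity and the first equation are double sums over \<open>I \<times> I\<close>,
  whose summands agree after symmetrisation under the exchange of the two indices.
\<close>

text \<open>Exchanging the summation indices leaves a double sum over \<open>I \<times> I\<close>
  unchanged, so twice the sum is the sum of the symmetrised summands. Cancelling the factor 2 is
  where characteristic zero enters.\<close>

lemma sum_symmetrization_eq:
  fixes F G :: "'i \<Rightarrow> 'i \<Rightarrow> ('k::field_char_0, 'a) tensor3"
  assumes "\<And>i j. F i j + F j i = G i j + G j i"
  shows "(\<Sum>i\<in>I. \<Sum>j\<in>I. F i j) = (\<Sum>i\<in>I. \<Sum>j\<in>I. G i j)"
proof (intro ext)
  fix f g h
  have double: "2 * (\<Sum>i\<in>I. \<Sum>j\<in>I. H i j f g h) = (\<Sum>i\<in>I. \<Sum>j\<in>I. (H i j + H j i) f g h)"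
    for H :: "'i \<Rightarrow> 'i \<Rightarrow> ('k, 'a) tensor3"
    using sum.swap[of "\<lambda>i j. H i j f g h" I I] by (simp add: sum.distrib)
  have "2 * (\<Sum>i\<in>I. \<Sum>j\<in>I. F i j f g h) = 2 * (\<Sum>i\<in>I. \<Sum>j\<in>I. G i j f g h)"
    unfolding double assms ..
  then show "(\<Sum>i\<in>I. \<Sum>j\<in>I. F i j) f g h = (\<Sum>i\<in>I. \<Sum>j\<in>I. G i j) f g h"
    by (simp add: sum_fun_apply)
qed

text \<open>Membership in the locale \<open>additive\<close> yields at once that each operator
  commutes with sums, differences and negation and maps 0 to 0. For \<open>append_right\<close> it
  is the tensor that varies, with the vector fixed.\<close>

lemma additive_operators:
  fixes s :: "'k::field \<Rightarrow> 'a::ab_group_add \<Rightarrow> 'a"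
  shows "additive (flip2 :: ('k, 'a) tensor2 \<Rightarrow> _)" "additive (flip12 :: ('k, 'a) tensor3 \<Rightarrow> _)"
    "additive (tmap2 s \<phi> \<psi>)"
    "additive (tmap3 s \<phi> \<psi> \<chi>)"
    "additive (\<lambda>t. append_right s t z)" "additive (append_left s z)"
    "additive (comap_left s D)" "additive (comap_right s D)"
  by (simp_all add: additive_def operators_additive)

lemma additive_T_op: "additive (T_op s m a)"
  by (simp add: additive_def T_op_def operators_additive)

lemmas operators_sum = additive_operators[THEN additive.sum] additive_T_op[THEN additive.sum]
lemmas operators_diff = additive_operators[THEN additive.diff] additive_T_op[THEN additive.diff]
lemmas operators_minus = additive_operators[THEN additive.minus] additive_T_op[THEN additive.minus]
lemmas operators_zero = additive_operators[THEN additive.zero] additive_T_op[THEN additive.zero]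

lemma additive_pure:
  "additive (\<lambda>u. pure2 s u v)" "additive (pure2 s u)"
  "additive (\<lambda>u. pure3 s u v w)" "additive (\<lambda>v. pure3 s u v w)" "additive (pure3 s u v)"
  by (simp_all add: additive_def pure2_bilinear pure3_trilinear)

lemmas pure_diff = additive_pure[THEN additive.diff]
lemmas pure_minus = additive_pure[THEN additive.minus]

locale anti_leibniz =
  fixes s :: "'k::field_char_0 \<Rightarrow> 'a::ab_group_add \<Rightarrow> 'a" and m :: "'a \<Rightarrow> 'a \<Rightarrow> 'a"
  assumes algebra: "anti_leibniz_algebra s m"
begin

lemma linear_mult: "Vector_Spaces.linear s s (\<lambda>b. m a b)" "Vector_Spaces.linear s s (\<lambda>b. m b a)"
  using algebra unfolding anti_leibniz_algebra_def by blast+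

sublocale V: vector_space s
  using linear_mult(1)[of 0] by (simp add: Vector_Spaces.linear_def)

sublocale L: Vector_Spaces.linear s s "\<lambda>b. m a b" for a by (rule linear_mult)
sublocale R: Vector_Spaces.linear s s "\<lambda>b. m b a" for a by (rule linear_mult)

lemmas mult_simps = L.add R.add L.diff R.diff L.neg R.neg

text \<open>Oriented as a rewrite rule towards right-nested products. This normalises products of
  three letters, and longer ones never share a leg below. The right-hand side is symmetric in
  \<open>a\<close> and \<open>b\<close>, so \<open>(ab)c = (ba)c\<close>.\<close>

lemma mult_assoc: "m (m a b) c = - m a (m b c) - m b (m a c)"
proof -
  have "m a (m b c) + m (m a b) c + m b (m a c) = 0"
    using algebra unfolding anti_leibniz_algebra_def by blast
  then show ?thesis by (simp add: algebra_simps eq_neg_iff_add_eq_0)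
qed

text \<open>These discharge the linearity premises of \<open>tmap2_pure\<close> and
  \<open>tmap3_pure\<close>; the differences are pointwise, as in \<open>T_op\<close> and in the
  equations of the theorem.\<close>

lemma linear_operators:
  "Vector_Spaces.linear s s id"
  "Vector_Spaces.linear s s (lmul m a)" "Vector_Spaces.linear s s (rmul m a)"
  "Vector_Spaces.linear s s (lmul m a - rmul m a)" "Vector_Spaces.linear s s (rmul m a - lmul m a)"
  by (unfold_locales;
      simp add: lmul_def rmul_def mult_simps L.scale R.scale V.scale_right_diff_distrib
        V.scale_right_distrib)+

lemma T_op_pure:
  "T_op s m a (pure2 s u v) = pure2 s (m u a) v - pure2 s (m a u) v + pure2 s u (m v a)"
  unfolding T_op_def
  by (simp add: tmap2_pure linear_operators pure_diff) (simp add: lmul_def rmul_def pure_diff)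

context
  fixes I :: "'i set" and x y :: "'i \<Rightarrow> 'a" and r :: "('k, 'a) tensor2"
  assumes r: "r = (\<Sum>i\<in>I. pure2 s (x i) (y i))"
begin

lemma Delta_r_sum: "Delta_r s m r a = (\<Sum>i\<in>I. T_op s m a (pure2 s (x i) (y i)))"
  unfolding Delta_r_def r by (rule operators_sum)

text \<open>Besides being part of the coalgebra axioms, this is the premise of
  \<open>comap_pure\<close>, which evaluates the iterated coproducts.\<close>

lemma linear_Delta_r: "Vector_Spaces.linear s scale2 (Delta_r s m r)"
proof -
  interpret W: vector_space "scale2 :: 'k \<Rightarrow> ('k, 'a) tensor2 \<Rightarrow> _" by (rule vector_space_scale2)
  show ?thesis
    by (unfold_locales; simp add: Delta_r_sum T_op_pure mult_simps L.scale R.scale pure2_bilinear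
        W.scale_sum_right W.scale_right_diff_distrib W.scale_right_distrib
        flip: sum.distrib; simp add: algebra_simps)
qed

lemma range_Delta_r: "range (Delta_r s m r) \<subseteq> tensors2 s"
proof -
  interpret W: vector_space "scale2 :: 'k \<Rightarrow> ('k, 'a) tensor2 \<Rightarrow> _" by (rule vector_space_scale2)
  have "T_op s m a (pure2 s u v) \<in> tensors2 s" for a u v
    unfolding T_op_pure tensors2_def
    by (intro W.span_add W.span_diff pure2_in_tensors2[unfolded tensors2_def])
  then show ?thesis by (auto simp: Delta_r_sum tensors2_def intro!: W.span_sum)
qed

lemma skew_part_sum:
  "r - flip2 r = (\<Sum>i\<in>I. pure2 s (x i) (y i) - pure2 s (y i) (x i))"
  by (simp add: r operators_sum flip_pure sum_subtractf)

text \<open>Both sides are linear in \<open>a\<close> and quadratic in \<open>r\<close>: each term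
  spreads the letters \<open>a\<close>, \<open>x i\<close>, \<open>y i\<close>, \<open>x j\<close>,
  \<open>y j\<close> over three nonempty legs, so a leg carries at most three letters and
  \<open>mult_assoc\<close> with bilinearity decides equality. As this is an identity, the coalgebra
  axiom and the first equation are equivalent.\<close>

lemma coassociator_Delta_r:
  "comap_left s (Delta_r s m r) (Delta_r s m r a)
     + comap_right s (Delta_r s m r) (Delta_r s m r a)
     + flip12 (comap_right s (Delta_r s m r) (Delta_r s m r a)) =
   tmap3 s (lmul m a - rmul m a) id id (yb_bracket s m I x y)
     + (tmap3 s id id (rmul m a)
          (flip12 (yb_bracket s m I x y)
           + (\<Sum>i\<in>I. append_right s (T_op s m (x i) (r - flip2 r)) (y i)))
        + tmap3 s id (lmul m a - rmul m a) id
          (flip12 (yb_bracket s m I x y)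
           + (\<Sum>i\<in>I. append_right s (T_op s m (x i) (r - flip2 r)) (y i))))
     + (\<Sum>j\<in>I. tmap3 s (lmul m (x j) - rmul m (x j)) id id
          (append_right s (flip2 (T_op s m a (r - flip2 r))) (y j)))"
  (is "?C = ?E")
proof -
  \<comment> \<open>\<open>t\<close>, \<open>u\<close> and \<open>B\<close> are the summands of
    \<open>r\<close>, of \<open>r - \<tau>(r)\<close> and of \<open>[[r,r]]\<close>.\<close>
  define t where "t i = pure2 s (x i) (y i)" for i
  define u where "u i = pure2 s (x i) (y i) - pure2 s (y i) (x i)" for i
  define B where "B i j =
      pure3 s (m (x i) (x j)) (y i) (y j) + pure3 s (x i) (m (y i) (x j)) (y j)
      - pure3 s (x j) (m (x i) (y j)) (y i) - pure3 s (x j) (x i) (m (y i) (y j))" for i j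
  \<comment> \<open>The index \<open>i\<close> belongs to the outer coproduct of \<open>a\<close>,
    whose three pure tensors come from \<open>T_op_pure\<close>; \<open>j\<close> belongs to the
    coproduct then applied to one leg, the second in \<open>K\<close> and the first in
    \<open>H\<close>.\<close>
  define K where "K i j = append_left s (x i) (T_op s m (m (y i) a) (t j))
      + append_left s (m (x i) a) (T_op s m (y i) (t j))
      - append_left s (m a (x i)) (T_op s m (y i) (t j))" for i j
  define H where "H i j = append_right s (T_op s m (m (x i) a) (t j)) (y i)
      - append_right s (T_op s m (m a (x i)) (t j)) (y i)
      + append_right s (T_op s m (x i) (t j)) (m (y i) a)" for i j
  define C where "C i j = H i j + K i j + flip12 (K i j)" for i j
  define W where "W i j = flip12 (B i j) + append_right s (T_op s m (x i) (u j)) (y i)" for i j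
  \<comment> \<open>The bound index \<open>j\<close> of the last sum in the statement is renamed
    \<open>i\<close> here, so that \<open>j\<close> can number the summands of
    \<open>r - \<tau>(r)\<close>.\<close>
  define E where "E i j = tmap3 s (lmul m a - rmul m a) id id (B i j)
      + (tmap3 s id id (rmul m a) (W i j) + tmap3 s id (lmul m a - rmul m a) id (W i j))
      + tmap3 s (lmul m (x i) - rmul m (x i)) id id
          (append_right s (flip2 (T_op s m a (u j))) (y i))" for i j
  have Delta: "Delta_r s m r b = (\<Sum>j\<in>I. T_op s m b (t j))" for b
    unfolding Delta_r_sum t_def ..
  have "comap_left s (Delta_r s m r) (Delta_r s m r a) = (\<Sum>i\<in>I. \<Sum>j\<in>I. H i j)"
    unfolding Delta[of a] t_def T_op_pure operators_sum operators_diff operators_additive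
      comap_pure[OF linear_Delta_r]
    by (simp add: Delta operators_sum H_def sum.distrib sum_subtractf)
  moreover have K: "comap_right s (Delta_r s m r) (Delta_r s m r a) = (\<Sum>i\<in>I. \<Sum>j\<in>I. K i j)"
    unfolding Delta[of a] t_def T_op_pure operators_sum operators_diff operators_additive
      comap_pure[OF linear_Delta_r]
    by (simp add: Delta operators_sum K_def sum.distrib sum_subtractf algebra_simps)
  ultimately have C: "?C = (\<Sum>i\<in>I. \<Sum>j\<in>I. C i j)"
    by (simp add: C_def sum.distrib operators_sum)
  have W: "flip12 (yb_bracket s m I x y)
           + (\<Sum>i\<in>I. append_right s (T_op s m (x i) (r - flip2 r)) (y i)) =
      (\<Sum>i\<in>I. \<Sum>j\<in>I. W i j)"
    by (simp add: yb_bracket_def skew_part_sum operators_sum W_def sum.distrib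
        flip: B_def u_def)
  have E: "?E = (\<Sum>i\<in>I. \<Sum>j\<in>I. E i j)"
    unfolding W
    by (simp add: yb_bracket_def skew_part_sum operators_sum E_def sum.distrib
        flip: B_def u_def)
  \<comment> \<open>Symmetrisation is essential: in \<open>W i j\<close>, for instance, the term
    \<open>y i x j \<otimes> x i \<otimes> y j\<close> of the flipped bracket and the term
    \<open>- y j x i \<otimes> x j \<otimes> y i\<close> coming from \<open>u j\<close> cancel only
    after \<open>i\<close> and \<open>j\<close> are exchanged.\<close>
  have "C i j + C j i = E i j + E j i" for i j
    unfolding C_def H_def K_def E_def W_def B_def t_def u_def
    by (simp add: T_op_pure operators_diff operators_minus operators_additive flip_pure append_pure tmap3_pure
        linear_operators pure3_trilinear pure_diff pure_minus mult_assoc mult_simps)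
       (simp add: lmul_def rmul_def pure3_trilinear pure_diff pure_minus mult_assoc mult_simps
        algebra_simps)
  then show ?thesis unfolding C E by (rule sum_symmetrization_eq)
qed

text \<open>Both sides are linear in \<open>r\<close>, so they can be compared on each
  \<open>x i \<otimes> y i\<close> separately, without symmetrising. Four letters on two nonempty
  legs again leave at most three on a leg.\<close>

lemma compatibility1_Delta_r:
  fixes a1 a2 defines "D \<equiv> Delta_r s m r"
  shows
  "D (m a1 a2)
      + (tmap2 s id (rmul m a2) (D a1 - flip2 (D a1))
         - tmap2 s (rmul m a2) id (D a1 - flip2 (D a1))
         + tmap2 s (lmul m a2) id (D a1 - flip2 (D a1)))
      + (tmap2 s id (lmul m a1) (D a2) + tmap2 s (lmul m a1) id (D a2)) =
   (tmap2 s (rmul m a2 - lmul m a2) id (flip2 (T_op s m a1 (r - flip2 r)))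
      + (tmap2 s (rmul m a2) id (T_op s m a1 (r - flip2 r))
         - flip2 (tmap2 s (rmul m a2) id (T_op s m a1 (r - flip2 r)))))
   + flip2 (tmap2 s (rmul m a1) id (T_op s m a2 (r - flip2 r)))"
  unfolding D_def Delta_r_sum skew_part_sum operators_sum sum.distrib[symmetric]
    sum_subtractf[symmetric]
  by (intro sum.cong refl)
     (simp add: T_op_pure operators_diff operators_additive flip_pure tmap2_pure linear_operators,
      simp add: lmul_def rmul_def pure2_bilinear pure_diff pure_minus mult_assoc mult_simps
        algebra_simps)

text \<open>Since \<open>(x a2) a1 = (a2 x) a1\<close>, the first two terms of
  \<open>T_op_pure\<close> cancel after right multiplication by \<open>a1\<close> on the first leg,
  leaving \<open>x a1 \<otimes> y a2\<close>. The flipped expression likewise gives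
  \<open>y a1 \<otimes> x a2\<close>, the contribution of \<open>\<tau>(r)\<close> on the
  right.\<close>

lemma compatibility2_Delta_r:
  "tmap2 s (rmul m a1) id (Delta_r s m r a2) - flip2 (tmap2 s (rmul m a2) id (Delta_r s m r a1)) =
   tmap2 s (rmul m a1) id (T_op s m a2 (r - flip2 r))"
  unfolding Delta_r_sum skew_part_sum operators_sum sum.distrib[symmetric] sum_subtractf[symmetric]
  by (intro sum.cong refl)
     (simp add: T_op_pure operators_diff operators_additive flip_pure tmap2_pure linear_operators,
      simp add: lmul_def rmul_def pure2_bilinear pure_diff pure_minus mult_assoc mult_simps
        algebra_simps)

end

end

theorem corollary3p4:
  fixes s :: "'k::field_char_0 \<Rightarrow> 'a::ab_group_add \<Rightarrow> 'a"
    and Basis :: "'a set"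
    and m :: "'a \<Rightarrow> 'a \<Rightarrow> 'a"
    and I :: "'i set"
    and x y :: "'i \<Rightarrow> 'a"
    and r :: "('k, 'a) tensor2"
  assumes "finite_dimensional_vector_space s Basis"
    and "anti_leibniz_algebra s m"
    and "finite I"
    and "r = (\<Sum>i\<in>I. pure2 s (x i) (y i))"
  shows
    "(anti_leibniz_bialgebra s m (Delta_r s m r) \<longleftrightarrow>
       (\<forall>a.
          tmap3 s (lmul m a - rmul m a) id id (yb_bracket s m I x y)
          + (tmap3 s id id (rmul m a)
               (flip12 (yb_bracket s m I x y)
                + (\<Sum>i\<in>I. append_right s (T_op s m (x i) (r - flip2 r)) (y i)))
             + tmap3 s id (lmul m a - rmul m a) id
               (flip12 (yb_bracket s m I x y)
                + (\<Sum>i\<in>I. append_right s (T_op s m (x i) (r - flip2 r)) (y i))))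
          + (\<Sum>j\<in>I. tmap3 s (lmul m (x j) - rmul m (x j)) id id
               (append_right s (flip2 (T_op s m a (r - flip2 r))) (y j)))
          = 0) \<and>
       (\<forall>a1 a2.
          (tmap2 s (rmul m a2 - lmul m a2) id (flip2 (T_op s m a1 (r - flip2 r)))
           + (tmap2 s (rmul m a2) id (T_op s m a1 (r - flip2 r))
              - flip2 (tmap2 s (rmul m a2) id (T_op s m a1 (r - flip2 r)))))
          + flip2 (tmap2 s (rmul m a1) id (T_op s m a2 (r - flip2 r)))
          = 0) \<and>
       (\<forall>a1 a2. tmap2 s (rmul m a1) id (T_op s m a2 (r - flip2 r)) = 0))
     \<and> (invariant2 s m (r - flip2 r) \<and> yb_bracket s m I x y = 0 \<longrightarrow>
          anti_leibniz_bialgebra s m (Delta_r s m r))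
     \<and> (r = flip2 r \<and> yb_bracket s m I x y = 0 \<longrightarrow>
          anti_leibniz_bialgebra s m (Delta_r s m r))"
proof -
  interpret anti_leibniz s m by unfold_locales (rule assms(2))
  note r = assms(4)
  let ?B = "yb_bracket s m I x y"
  \<comment> \<open>The three identities turn the coalgebra identity and the two compatibility
    conditions into the three equations one by one; what remains of the bialgebra axioms is the
    algebra structure and that \<open>Delta_r\<close> is linear with values in
    \<open>A \<otimes> A\<close>.\<close>
  have char: "anti_leibniz_bialgebra s m (Delta_r s m r) \<longleftrightarrow>
      (\<forall>a. tmap3 s (lmul m a - rmul m a) id id ?B
          + (tmap3 s id id (rmul m a)
               (flip12 ?B + (\<Sum>i\<in>I. append_right s (T_op s m (x i) (r - flip2 r)) (y i)))
             + tmap3 s id (lmul m a - rmul m a) id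
               (flip12 ?B + (\<Sum>i\<in>I. append_right s (T_op s m (x i) (r - flip2 r)) (y i))))
          + (\<Sum>j\<in>I. tmap3 s (lmul m (x j) - rmul m (x j)) id id
               (append_right s (flip2 (T_op s m a (r - flip2 r))) (y j)))
          = 0) \<and>
       (\<forall>a1 a2.
          (tmap2 s (rmul m a2 - lmul m a2) id (flip2 (T_op s m a1 (r - flip2 r)))
           + (tmap2 s (rmul m a2) id (T_op s m a1 (r - flip2 r))
              - flip2 (tmap2 s (rmul m a2) id (T_op s m a1 (r - flip2 r)))))
          + flip2 (tmap2 s (rmul m a1) id (T_op s m a2 (r - flip2 r)))
          = 0) \<and>
       (\<forall>a1 a2. tmap2 s (rmul m a1) id (T_op s m a2 (r - flip2 r)) = 0)"
    unfolding anti_leibniz_bialgebra_def anti_leibniz_coalgebra_def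
      coassociator_Delta_r[OF r] compatibility1_Delta_r[OF r] compatibility2_Delta_r[OF r]
    using assms(2) linear_Delta_r[OF r] range_Delta_r[OF r] by blast
  \<comment> \<open>Every term of the three equations is built by additive operators from the
    bracket or from some \<open>T_op s m b (r - flip2 r)\<close>, all of which are 0 here.\<close>
  have inv: "anti_leibniz_bialgebra s m (Delta_r s m r)"
    if "invariant2 s m (r - flip2 r)" and B: "?B = 0"
  proof -
    have T: "T_op s m a (r - flip2 r) = 0" for a
      using that(1) unfolding invariant2_def by blast
    show ?thesis unfolding char T B operators_zero by (simp add: operators_zero)
  qed
  \<comment> \<open>Case (ii) is an instance of case (i), because \<open>T_op\<close> maps 0 to
    0.\<close>
  have "invariant2 s m (r - flip2 r)" if "r = flip2 r"
    using that by (simp add: invariant2_def operators_zero)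
  with char inv show ?thesis by blast
qed

end
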